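(* Let $\mathbf{A}$ be a commutative bimonoid with transformation functions $\alpha,\beta\colon A\times A\to A$. Let $P$ be the algebra on $A\times A$ with operations $\overline{(a,b)}:=(\beta(a,b),\alpha(a,b))$, $(a,b)\circ(c,d):=(a\cdot c,b+d)$, $(a,b)\oplus(c,d):=(\beta(s,t),\alpha(s,t))$ where $s=\beta(a,b)\cdot\beta(c,d)$ and $t=\alpha(a,b)+\alpha(c,d)$, and constants $1^{\div}:=(1,0)$, $0^{\div}:=(0,0)$. Let $\preccurlyeq$ be the preorder on $A\times A$ given by $(a,b)\preccurlyeq(c,d)$ iff for all $x,y\in A$, $x\cdot c\leq y+d$ implies $x\cdot a\leq y+b$, and let $\theta$ be the equivalence relation induced by $\preccurlyeq$. Then $\theta$ is a congruence of $P$, and the ordered algebra $P/\theta$ ordered by $\preccurlyeq$ (with multiplication $\circ$, unit $1^{\div}$, addition $\oplus$, unit $0^{\div}$) is a commutative complemented bimonoid of fractions of $\mathbf{A}$ with respect to the embedding $\iota^{\div}\colon a\mapsto[(a,0)]_\theta$; moreover $\iota^{\div}(a)\circ\overline{\iota^{\div}(b)}=[(a,b)]_\theta$ for all $a,b\in A$, and the complement of $[(a,b)]_\theta$ is $[(\beta(a,b),\alpha(a,b))]_\theta$.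
   Context: A bimonoid $\langle A,\leq,\cdot,1,+,0\rangle$ is a poset with two monoid structures ($\cdot$ with unit $1$, $+$ with unit $0$), both operations order preserving in each argument, satisfying hemidistributivity $x\cdot(y+z)\leq(x\cdot y)+z$ and $(z+y)\cdot x\leq z+(y\cdot x)$; commutative if both operations are commutative. Embeddings are order embeddings preserving $\cdot,1,+,0$. In a commutative bimonoid, $y$ is a complement of $x$ if $x\cdot y\leq 0$ and $1\leq x+y$; unique if it exists, written $\overline{x}$; complemented means every element has one; complete means the order is a complete lattice. A commutative complemented Dedekind--MacNeille completion $\mathbf{A}^{\Delta}$ of $\mathbf{A}$ is a complete complemented commutative bimonoid containing $\mathbf{A}$ as a sub-bimonoid such that elements $a\cdot\overline{b}$ ($a,b\in\mathbf{A}$) are join dense and elements $a+\overline{b}$ are meet dense in it; it exists and is unique up to isomorphism over $\mathbf{A}$. Functions $\alpha,\beta\colon A\times A\to A$ are transformation functions for $\mathbf{A}$ if $a\cdot\overline{b}=\alpha(a,b)+\overline{\beta(a,b)}$ in $\mathbf{A}^{\Delta}$ for all $a,b\in A$. A commutative complemented bimonoid of fractions of $\mathbf{A}$ is a complemented commutative bimonoid $\mathbf{C}$ with an embedding $e\colon\mathbf{A}\hookrightarrow\mathbf{C}$ such that every element of $\mathbf{C}$ can be written as $e(a)\cdot\overline{e(b)}$ and as $e(c)+\overline{e(d)}$ for some $a,b,c,d\in\mathbf{A}$. *)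

theory Defs
  imports "HOL-Algebra.Ring" "HOL-Algebra.Complete_Lattice"
begin

text \<open>The two monoids are the multiplicative and the additive reduct of a HOL-Algebra ring
  record; nothing else about rings is used.\<close>

record 'a bimonoid = "'a ring" +
  ble :: "'a \<Rightarrow> 'a \<Rightarrow> bool"  (infixl \<open>\<preceq>\<index>\<close> 50)

abbreviation order_reduct :: "('a, 'm) bimonoid_scheme \<Rightarrow> 'a gorder" where
  "order_reduct A \<equiv> \<lparr>carrier = carrier A, eq = (=), le = ble A\<rparr>"

locale bimonoid =
  fixes A :: "('a, 'm) bimonoid_scheme" (structure)
  assumes order: "partial_order (order_reduct A)"
    and mult_monoid: "monoid A"
    and add_monoid: "monoid (add_monoid A)"
    and mult_mono_left: "\<lbrakk>x \<in> carrier A; y \<in> carrier A; z \<in> carrier A; x \<preceq> y\<rbrakk> \<Longrightarrow> x \<otimes> z \<preceq> y \<otimes> z"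
    and mult_mono_right: "\<lbrakk>x \<in> carrier A; y \<in> carrier A; z \<in> carrier A; x \<preceq> y\<rbrakk> \<Longrightarrow> z \<otimes> x \<preceq> z \<otimes> y"
    and add_mono_left: "\<lbrakk>x \<in> carrier A; y \<in> carrier A; z \<in> carrier A; x \<preceq> y\<rbrakk> \<Longrightarrow> x \<oplus> z \<preceq> y \<oplus> z"
    and add_mono_right: "\<lbrakk>x \<in> carrier A; y \<in> carrier A; z \<in> carrier A; x \<preceq> y\<rbrakk> \<Longrightarrow> z \<oplus> x \<preceq> z \<oplus> y"
    and hemidist_left: "\<lbrakk>x \<in> carrier A; y \<in> carrier A; z \<in> carrier A\<rbrakk>
      \<Longrightarrow> x \<otimes> (y \<oplus> z) \<preceq> (x \<otimes> y) \<oplus> z"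
    and hemidist_right: "\<lbrakk>x \<in> carrier A; y \<in> carrier A; z \<in> carrier A\<rbrakk>
      \<Longrightarrow> (z \<oplus> y) \<otimes> x \<preceq> z \<oplus> (y \<otimes> x)"

locale comm_bimonoid = bimonoid +
  assumes mult_comm: "\<lbrakk>x \<in> carrier A; y \<in> carrier A\<rbrakk> \<Longrightarrow> x \<otimes> y = y \<otimes> x"
    and add_comm: "\<lbrakk>x \<in> carrier A; y \<in> carrier A\<rbrakk> \<Longrightarrow> x \<oplus> y = y \<oplus> x"

definition is_complement :: "('a, 'm) bimonoid_scheme \<Rightarrow> 'a \<Rightarrow> 'a \<Rightarrow> bool" where
  "is_complement A x y \<longleftrightarrow> y \<in> carrier A \<and> x \<otimes>\<^bsub>A\<^esub> y \<preceq>\<^bsub>A\<^esub> \<zero>\<^bsub>A\<^esub> \<and> \<one>\<^bsub>A\<^esub> \<preceq>\<^bsub>A\<^esub> x \<oplus>\<^bsub>A\<^esub> y"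

definition compl :: "('a, 'm) bimonoid_scheme \<Rightarrow> 'a \<Rightarrow> 'a" where
  "compl A x = (THE y. is_complement A x y)"

locale complemented_comm_bimonoid = comm_bimonoid +
  assumes ex_complement: "x \<in> carrier A \<Longrightarrow> \<exists>y. is_complement A x y"

definition bimonoid_embedding ::
    "('a, 'm) bimonoid_scheme \<Rightarrow> ('b, 'n) bimonoid_scheme \<Rightarrow> ('a \<Rightarrow> 'b) \<Rightarrow> bool" where
  "bimonoid_embedding A B e \<longleftrightarrow>
     e \<in> carrier A \<rightarrow> carrier B \<and>
     (\<forall>x\<in>carrier A. \<forall>y\<in>carrier A. e x \<preceq>\<^bsub>B\<^esub> e y \<longleftrightarrow> x \<preceq>\<^bsub>A\<^esub> y) \<and>
     (\<forall>x\<in>carrier A. \<forall>y\<in>carrier A. e (x \<otimes>\<^bsub>A\<^esub> y) = e x \<otimes>\<^bsub>B\<^esub> e y) \<and>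
     (\<forall>x\<in>carrier A. \<forall>y\<in>carrier A. e (x \<oplus>\<^bsub>A\<^esub> y) = e x \<oplus>\<^bsub>B\<^esub> e y) \<and>
     e \<one>\<^bsub>A\<^esub> = \<one>\<^bsub>B\<^esub> \<and> e \<zero>\<^bsub>A\<^esub> = \<zero>\<^bsub>B\<^esub>"

definition join_dense :: "('a, 'm) gorder_scheme \<Rightarrow> 'a set \<Rightarrow> bool" where
  "join_dense L S \<longleftrightarrow> S \<subseteq> carrier L \<and> (\<forall>x\<in>carrier L. \<exists>X\<subseteq>S. is_lub L x X)"

definition meet_dense :: "('a, 'm) gorder_scheme \<Rightarrow> 'a set \<Rightarrow> bool" where
  "meet_dense L S \<longleftrightarrow> S \<subseteq> carrier L \<and> (\<forall>x\<in>carrier L. \<exists>X\<subseteq>S. is_glb L x X)"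

text \<open>Containment of \<open>A\<close> in its completion \<open>D\<close> is expressed by an embedding \<open>e\<close>.\<close>

definition comm_compl_DM_completion ::
    "('a, 'm) bimonoid_scheme \<Rightarrow> ('d, 'n) bimonoid_scheme \<Rightarrow> ('a \<Rightarrow> 'd) \<Rightarrow> bool" where
  "comm_compl_DM_completion A D e \<longleftrightarrow>
     complemented_comm_bimonoid D \<and>
     complete_lattice (order_reduct D) \<and>
     bimonoid_embedding A D e \<and>
     join_dense (order_reduct D) {e a \<otimes>\<^bsub>D\<^esub> compl D (e b) | a b. a \<in> carrier A \<and> b \<in> carrier A} \<and>
     meet_dense (order_reduct D) {e a \<oplus>\<^bsub>D\<^esub> compl D (e b) | a b. a \<in> carrier A \<and> b \<in> carrier A}"

definition transformation_functions ::
    "('a, 'm) bimonoid_scheme \<Rightarrow> ('d, 'n) bimonoid_scheme \<Rightarrow> ('a \<Rightarrow> 'd) \<Rightarrow>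
     ('a \<times> 'a \<Rightarrow> 'a) \<Rightarrow> ('a \<times> 'a \<Rightarrow> 'a) \<Rightarrow> bool" where
  "transformation_functions A D e \<alpha> \<beta> \<longleftrightarrow>
     \<alpha> \<in> carrier A \<times> carrier A \<rightarrow> carrier A \<and>
     \<beta> \<in> carrier A \<times> carrier A \<rightarrow> carrier A \<and>
     (\<forall>a\<in>carrier A. \<forall>b\<in>carrier A.
        e a \<otimes>\<^bsub>D\<^esub> compl D (e b) = e (\<alpha> (a, b)) \<oplus>\<^bsub>D\<^esub> compl D (e (\<beta> (a, b))))"

definition comm_compl_bimonoid_of_fractions ::
    "('a, 'm) bimonoid_scheme \<Rightarrow> ('c, 'n) bimonoid_scheme \<Rightarrow> ('a \<Rightarrow> 'c) \<Rightarrow> bool" where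
  "comm_compl_bimonoid_of_fractions A C e \<longleftrightarrow>
     complemented_comm_bimonoid C \<and>
     bimonoid_embedding A C e \<and>
     (\<forall>x\<in>carrier C.
        (\<exists>a\<in>carrier A. \<exists>b\<in>carrier A. x = e a \<otimes>\<^bsub>C\<^esub> compl C (e b)) \<and>
        (\<exists>c\<in>carrier A. \<exists>d\<in>carrier A. x = e c \<oplus>\<^bsub>C\<^esub> compl C (e d)))"

text \<open>Ordered algebras in the signature of bimonoids with an additional unary operation, which
  is not required to be complementation.\<close>

record 'a bimonoid_alg = "'a bimonoid" +
  neg :: "'a \<Rightarrow> 'a"

definition congruence :: "('a, 'm) bimonoid_alg_scheme \<Rightarrow> ('a \<times> 'a) set \<Rightarrow> bool" where
  "congruence P \<theta> \<longleftrightarrow>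
     equiv (carrier P) \<theta> \<and>
     (\<forall>(p, p')\<in>\<theta>. (neg P p, neg P p') \<in> \<theta>) \<and>
     (\<forall>(p, p')\<in>\<theta>. \<forall>(q, q')\<in>\<theta>. (p \<otimes>\<^bsub>P\<^esub> q, p' \<otimes>\<^bsub>P\<^esub> q') \<in> \<theta>) \<and>
     (\<forall>(p, p')\<in>\<theta>. \<forall>(q, q')\<in>\<theta>. (p \<oplus>\<^bsub>P\<^esub> q, p' \<oplus>\<^bsub>P\<^esub> q') \<in> \<theta>)"

text \<open>The unions below are over representatives, so they are single \<open>\<theta>\<close>-classes whenever \<open>\<theta>\<close> is a
  congruence; similarly, the order does not depend on representatives when \<open>\<theta>\<close> is the
  equivalence induced by a preorder \<open>ble P\<close>.\<close>

definition quotient_alg :: "'a bimonoid_alg \<Rightarrow> ('a \<times> 'a) set \<Rightarrow> 'a set bimonoid_alg" where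
  "quotient_alg P \<theta> =
     \<lparr>carrier = carrier P // \<theta>,
      mult = (\<lambda>X Y. \<Union>p\<in>X. \<Union>q\<in>Y. \<theta> `` {p \<otimes>\<^bsub>P\<^esub> q}),
      one = \<theta> `` {\<one>\<^bsub>P\<^esub>},
      zero = \<theta> `` {\<zero>\<^bsub>P\<^esub>},
      add = (\<lambda>X Y. \<Union>p\<in>X. \<Union>q\<in>Y. \<theta> `` {p \<oplus>\<^bsub>P\<^esub> q}),
      ble = (\<lambda>X Y. \<exists>p\<in>X. \<exists>q\<in>Y. p \<preceq>\<^bsub>P\<^esub> q),
      neg = (\<lambda>X. \<Union>p\<in>X. \<theta> `` {neg P p})\<rparr>"

text \<open>The pair \<open>(a, b)\<close> stands for \<open>a\<close> times the complement of \<open>b\<close>.\<close>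

definition frac_le :: "('a, 'm) bimonoid_scheme \<Rightarrow> 'a \<times> 'a \<Rightarrow> 'a \<times> 'a \<Rightarrow> bool" where
  "frac_le A = (\<lambda>(a, b) (c, d).
     \<forall>x\<in>carrier A. \<forall>y\<in>carrier A.
       x \<otimes>\<^bsub>A\<^esub> c \<preceq>\<^bsub>A\<^esub> y \<oplus>\<^bsub>A\<^esub> d \<longrightarrow> x \<otimes>\<^bsub>A\<^esub> a \<preceq>\<^bsub>A\<^esub> y \<oplus>\<^bsub>A\<^esub> b)"

definition frac_equiv :: "('a, 'm) bimonoid_scheme \<Rightarrow> (('a \<times> 'a) \<times> ('a \<times> 'a)) set" where
  "frac_equiv A = {(p, q). p \<in> carrier A \<times> carrier A \<and> q \<in> carrier A \<times> carrier A \<and>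
     frac_le A p q \<and> frac_le A q p}"

definition frac_alg :: "('a, 'm) bimonoid_scheme \<Rightarrow> ('a \<times> 'a \<Rightarrow> 'a) \<Rightarrow> ('a \<times> 'a \<Rightarrow> 'a) \<Rightarrow>
    ('a \<times> 'a) bimonoid_alg" where
  "frac_alg A \<alpha> \<beta> =
     \<lparr>carrier = carrier A \<times> carrier A,
      mult = (\<lambda>(a, b) (c, d). (a \<otimes>\<^bsub>A\<^esub> c, b \<oplus>\<^bsub>A\<^esub> d)),
      one = (\<one>\<^bsub>A\<^esub>, \<zero>\<^bsub>A\<^esub>),
      zero = (\<zero>\<^bsub>A\<^esub>, \<zero>\<^bsub>A\<^esub>),
      add = (\<lambda>(a, b) (c, d).
        let s = \<beta> (a, b) \<otimes>\<^bsub>A\<^esub> \<beta> (c, d); t = \<alpha> (a, b) \<oplus>\<^bsub>A\<^esub> \<alpha> (c, d)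
        in (\<beta> (s, t), \<alpha> (s, t))),
      ble = frac_le A,
      neg = (\<lambda>(a, b). (\<beta> (a, b), \<alpha> (a, b)))\<rparr>"

context comm_bimonoid
begin

lemma m_closed: "x \<in> carrier A \<Longrightarrow> y \<in> carrier A \<Longrightarrow> x \<otimes> y \<in> carrier A"
  using mult_monoid by (rule monoid.m_closed)

lemma a_closed: "x \<in> carrier A \<Longrightarrow> y \<in> carrier A \<Longrightarrow> x \<oplus> y \<in> carrier A"
  using monoid.m_closed[OF add_monoid] by simp

lemma one_in: "\<one> \<in> carrier A"
  using mult_monoid by (rule monoid.one_closed)

lemma zero_in: "\<zero> \<in> carrier A"
  using monoid.one_closed[OF add_monoid] by simp

lemma m_one: "x \<in> carrier A \<Longrightarrow> \<one> \<otimes> x = x" "x \<in> carrier A \<Longrightarrow> x \<otimes> \<one> = x"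
  using monoid.l_one[OF mult_monoid] monoid.r_one[OF mult_monoid] by simp_all

lemma a_zero: "x \<in> carrier A \<Longrightarrow> \<zero> \<oplus> x = x" "x \<in> carrier A \<Longrightarrow> x \<oplus> \<zero> = x"
  using monoid.l_one[OF add_monoid] monoid.r_one[OF add_monoid] by simp_all

lemma m_assoc: "\<lbrakk>x \<in> carrier A; y \<in> carrier A; z \<in> carrier A\<rbrakk> \<Longrightarrow> (x \<otimes> y) \<otimes> z = x \<otimes> (y \<otimes> z)"
  using mult_monoid by (rule monoid.m_assoc)

lemma a_assoc: "\<lbrakk>x \<in> carrier A; y \<in> carrier A; z \<in> carrier A\<rbrakk> \<Longrightarrow> (x \<oplus> y) \<oplus> z = x \<oplus> (y \<oplus> z)"
  using monoid.m_assoc[OF add_monoid] by simp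

lemma ble_refl: "x \<in> carrier A \<Longrightarrow> x \<preceq> x"
proof -
  interpret O: partial_order "order_reduct A" by (rule order)
  show "x \<in> carrier A \<Longrightarrow> x \<preceq> x" using O.le_refl by simp
qed

lemma ble_trans: "\<lbrakk>x \<preceq> y; y \<preceq> z; x \<in> carrier A; y \<in> carrier A; z \<in> carrier A\<rbrakk> \<Longrightarrow> x \<preceq> z"
proof -
  interpret O: partial_order "order_reduct A" by (rule order)
  show "\<lbrakk>x \<preceq> y; y \<preceq> z; x \<in> carrier A; y \<in> carrier A; z \<in> carrier A\<rbrakk> \<Longrightarrow> x \<preceq> z"
    using O.le_trans by simp
qed

lemma ble_antisym: "\<lbrakk>x \<preceq> y; y \<preceq> x; x \<in> carrier A; y \<in> carrier A\<rbrakk> \<Longrightarrow> x = y"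
proof -
  interpret O: partial_order "order_reduct A" by (rule order)
  show "\<lbrakk>x \<preceq> y; y \<preceq> x; x \<in> carrier A; y \<in> carrier A\<rbrakk> \<Longrightarrow> x = y"
    using O.le_antisym by simp
qed

lemma complement_le:
  assumes "x \<in> carrier A" "is_complement A x y" "is_complement A x z"
  shows "y \<preceq> z"
proof -
  have c: "y \<in> carrier A" "z \<in> carrier A" and 1: "x \<otimes> y \<preceq> \<zero>" and 2: "\<one> \<preceq> x \<oplus> z"
    using assms by (auto simp: is_complement_def)
  note cl = assms(1) c m_closed a_closed one_in zero_in
  have a: "y \<preceq> y \<otimes> (x \<oplus> z)"
    using mult_mono_right[OF _ _ _ 2, of y] by (simp add: cl m_one)
  have b: "y \<otimes> (x \<oplus> z) \<preceq> (y \<otimes> x) \<oplus> z"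
    by (rule hemidist_left) (simp_all add: cl)
  have "y \<otimes> x \<preceq> \<zero>" using 1 mult_comm[of x y] cl by simp
  then have c: "(y \<otimes> x) \<oplus> z \<preceq> z"
    using add_mono_left[of "y \<otimes> x" \<zero> z] by (simp add: cl a_zero)
  show ?thesis
    by (rule ble_trans[OF a ble_trans[OF b c]]) (simp_all add: cl)
qed

lemma compl_eq:
  assumes "x \<in> carrier A" "is_complement A x y"
  shows "compl A x = y"
  unfolding compl_def
  by (rule the_equality, rule assms, rule ble_antisym)
     (use assms in \<open>auto intro: complement_le simp: is_complement_def\<close>)

lemma hemidist': 
  assumes "x \<in> carrier A" "y \<in> carrier A" "z \<in> carrier A"
  shows "x \<otimes> (y \<oplus> z) \<preceq> y \<oplus> (x \<otimes> z)"
  using hemidist_left[of x z y] assms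
  by (simp add: add_comm m_closed)

end

text \<open>Every commutative bimonoid has a completion: the facts of a phase space on pairs. The pair
  \<open>(a, b)\<close> again stands for \<open>a\<close> times the complement of \<open>b\<close>, so that \<open>(a, b)\<close> lies below the zero of
  the completion (the pole) iff \<open>a \<preceq> b\<close>.\<close>

locale phase_space =
  fixes G :: "'p set" and pm :: "'p \<Rightarrow> 'p \<Rightarrow> 'p" and u :: 'p and pole :: "'p set"
  assumes pm_closed: "p \<in> G \<Longrightarrow> q \<in> G \<Longrightarrow> pm p q \<in> G"
    and pm_comm: "p \<in> G \<Longrightarrow> q \<in> G \<Longrightarrow> pm p q = pm q p"
    and pm_assoc: "\<lbrakk>p \<in> G; q \<in> G; r \<in> G\<rbrakk> \<Longrightarrow> pm (pm p q) r = pm p (pm q r)"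
    and u_in: "u \<in> G"
    and pm_unit: "p \<in> G \<Longrightarrow> pm p u = p"
    and pole_sub: "pole \<subseteq> G"
begin

definition perp where "perp S = {p \<in> G. \<forall>q\<in>S. pm p q \<in> pole}"

definition sprod where "sprod S T = {pm p q | p q. p \<in> S \<and> q \<in> T}"

definition phase :: "'p set bimonoid" where
  "phase = \<lparr>carrier = {S. S \<subseteq> G \<and> perp (perp S) = S},
     mult = (\<lambda>S T. perp (perp (sprod S T))),
     one = perp (perp {u}),
     zero = perp {u},
     add = (\<lambda>S T. perp (sprod (perp S) (perp T))),
     ble = (\<subseteq>)\<rparr>"

lemma perp_sub: "perp S \<subseteq> G"
  by (auto simp: perp_def)

lemma sprodI: "p \<in> S \<Longrightarrow> q \<in> T \<Longrightarrow> pm p q \<in> sprod S T"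
  unfolding sprod_def by blast

lemma sprodE: assumes "r \<in> sprod S T" obtains p q where "r = pm p q" "p \<in> S" "q \<in> T"
  using assms unfolding sprod_def by blast

lemma sprod_sub: "S \<subseteq> G \<Longrightarrow> T \<subseteq> G \<Longrightarrow> sprod S T \<subseteq> G"
  by (auto elim!: sprodE intro: pm_closed)

lemma perp_anti: "S \<subseteq> T \<Longrightarrow> perp T \<subseteq> perp S"
  by (auto simp: perp_def)

lemma perp_ext: assumes "S \<subseteq> G" shows "S \<subseteq> perp (perp S)"
proof
  fix p assume p: "p \<in> S"
  then have pG: "p \<in> G" using assms by blast
  have "pm p q \<in> pole" if q: "q \<in> perp S" for q
  proof -
    have "q \<in> G" "pm q p \<in> pole" using q p by (simp_all add: perp_def)
    then show ?thesis using pm_comm[OF pG] by simp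
  qed
  then show "p \<in> perp (perp S)" using pG by (simp add: perp_def)
qed

lemma perp3: assumes "S \<subseteq> G" shows "perp (perp (perp S)) = perp S"
  using perp_anti[OF perp_ext[OF assms]] perp_ext[OF perp_sub[of S]] by blast

lemma sprod_comm: assumes "S \<subseteq> G" "T \<subseteq> G" shows "sprod S T = sprod T S"
proof -
  have *: "sprod S T \<subseteq> sprod T S" if "S \<subseteq> G" "T \<subseteq> G" for S T
  proof
    fix r assume "r \<in> sprod S T"
    then obtain p q where "r = pm p q" "p \<in> S" "q \<in> T" by (rule sprodE)
    then have "r = pm q p" using that pm_comm[of p q] by blast
    then show "r \<in> sprod T S" using \<open>p \<in> S\<close> \<open>q \<in> T\<close> by (simp add: sprodI)
  qed
  show ?thesis using *[OF assms] *[OF assms(2,1)] by blast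
qed

lemma sprod_assoc: assumes "S \<subseteq> G" "T \<subseteq> G" "U \<subseteq> G"
  shows "sprod (sprod S T) U = sprod S (sprod T U)"
proof (intro equalityI subsetI)
  fix w assume "w \<in> sprod (sprod S T) U"
  then obtain p q r where w: "w = pm (pm p q) r" and m: "p \<in> S" "q \<in> T" "r \<in> U"
    by (metis sprodE)
  have "w = pm p (pm q r)" using w m assms pm_assoc[of p q r] by (simp add: subset_eq)
  then show "w \<in> sprod S (sprod T U)" using m by (simp add: sprodI)
next
  fix w assume "w \<in> sprod S (sprod T U)"
  then obtain p q r where w: "w = pm p (pm q r)" and m: "p \<in> S" "q \<in> T" "r \<in> U"
    by (metis sprodE)
  have "w = pm (pm p q) r" using w m assms pm_assoc[of p q r] by (simp add: subset_eq)
  then show "w \<in> sprod (sprod S T) U" using m by (simp add: sprodI)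
qed

lemma sprod_unit: "S \<subseteq> G \<Longrightarrow> sprod S {u} = S"
proof (intro equalityI subsetI)
  assume S: "S \<subseteq> G"
  show "p \<in> S" if "p \<in> sprod S {u}" for p
    using that S pm_unit by (metis singletonD sprodE subsetD)
  show "p \<in> sprod S {u}" if "p \<in> S" for p
    using sprodI[OF that singletonI, of "u"] pm_unit[of p] S that by auto
qed

lemma sprod_mono: "S \<subseteq> S' \<Longrightarrow> T \<subseteq> T' \<Longrightarrow> sprod S T \<subseteq> sprod S' T'"
  by (auto elim!: sprodE intro: sprodI)

lemma perp_sprod_iff:
  assumes "S \<subseteq> G" "T \<subseteq> G" "p \<in> G"
  shows "p \<in> perp (sprod S T) \<longleftrightarrow> (\<forall>q\<in>T. pm p q \<in> perp S)"
proof -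
  have "pm p (pm q r) = pm (pm p r) q" if "q \<in> S" "r \<in> T" for q r
  proof -
    have "q \<in> G" "r \<in> G" using that assms by auto
    then show ?thesis using assms(3) by (metis pm_assoc pm_comm)
  qed
  moreover have "pm p r \<in> G" if "r \<in> T" for r using that assms pm_closed[of p r] by blast
  ultimately show ?thesis
    using assms(3) unfolding perp_def by (auto elim!: sprodE) (metis sprodI)+
qed

lemma perp_sprod_cl:
  assumes "S \<subseteq> G" "T \<subseteq> G"
  shows "perp (sprod (perp (perp S)) T) = perp (sprod S T)"
proof (rule Set.set_eqI)
  fix p
  show "p \<in> perp (sprod (perp (perp S)) T) \<longleftrightarrow> p \<in> perp (sprod S T)"
  proof (cases "p \<in> G")
    case True
    then show ?thesis
      using perp_sprod_iff[OF assms True] perp_sprod_iff[OF perp_sub assms(2) True] perp3[OF assms(1)] by simp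
  next
    case False
    then show ?thesis using perp_sub by blast
  qed
qed

lemma perp_sprod_cl':
  assumes "S \<subseteq> G" "T \<subseteq> G"
  shows "perp (sprod T (perp (perp S))) = perp (sprod T S)"
  using perp_sprod_cl[OF assms] assms by (simp add: sprod_comm perp_sub)

lemma perp_singleton: "p \<in> G \<Longrightarrow> q \<in> G \<Longrightarrow> q \<in> perp {p} \<longleftrightarrow> pm q p \<in> pole"
  by (auto simp: perp_def)

lemma unit_sub: "{u} \<subseteq> G"
  using u_in by simp

lemma in_perp_unit: "p \<in> perp {u} \<longleftrightarrow> p \<in> pole"
proof -
  show ?thesis using pm_unit[of p] pole_sub by (auto simp: perp_def)
qed

lemma sprod_perp_pole:
  assumes "S \<subseteq> G" shows "sprod S (perp S) \<subseteq> perp {u}"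
proof
  fix r assume "r \<in> sprod S (perp S)"
  then obtain p q where r: "r = pm p q" "p \<in> S" "q \<in> perp S" by (rule sprodE)
  have "q \<in> G" "pm q p \<in> pole" using r by (simp_all add: perp_def)
  then have "r \<in> pole" using r(1,2) assms pm_comm[of p q] by auto
  then show "r \<in> perp {u}" by (simp add: in_perp_unit)
qed

lemma perp_one_par: 
  assumes "S \<subseteq> G" shows "perp (perp {u}) \<subseteq> perp (sprod (perp S) (perp (perp S)))"
  by (rule perp_anti, rule sprod_perp_pole, rule perp_sub)

lemma phase_mult_par:
  assumes S: "S \<subseteq> G" "perp (perp S) = S" and T: "T \<subseteq> G" and U: "U \<subseteq> G"
  shows "sprod S (perp (sprod T U)) \<subseteq> perp (sprod (perp (sprod S (perp T))) U)"
proof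
  fix w assume "w \<in> sprod S (perp (sprod T U))"
  then obtain p q where w: "w = pm p q" and p: "p \<in> S" and q: "q \<in> perp (sprod T U)"
    by (rule sprodE)
  have pG: "p \<in> G" and qG: "q \<in> G" using p S q perp_sub by blast+
  have "pm w v \<in> perp (perp (sprod S (perp T)))" if v: "v \<in> U" for v
  proof -
    have vG: "v \<in> G" using v U by blast
    have "pm q v \<in> perp T" using q v perp_sprod_iff[OF T U qG] by blast
    then have "pm p (pm q v) \<in> sprod S (perp T)" using p by (simp add: sprodI)
    moreover have "pm w v = pm p (pm q v)" using w pm_assoc[OF pG qG vG] by simp
    ultimately show ?thesis using perp_ext[OF sprod_sub[OF S(1) perp_sub]] by auto
  qed
  moreover have "w \<in> G" using w pm_closed[OF pG qG] by simp
  ultimately show "w \<in> perp (sprod (perp (sprod S (perp T))) U)"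
    using perp_sprod_iff[OF perp_sub U] by blast
qed

lemma phase_comm_bimonoid: "comm_bimonoid phase"
proof (intro comm_bimonoid.intro bimonoid.intro comm_bimonoid_axioms.intro)
  let ?D = phase
  have cD: "S \<in> carrier ?D \<longleftrightarrow> S \<subseteq> G \<and> perp (perp S) = S" for S by (simp add: phase_def)
  have perpD: "perp S \<in> carrier ?D" if "S \<subseteq> G" for S using that by (simp add: cD perp_sub perp3)
  have m: "S \<otimes>\<^bsub>?D\<^esub> T = perp (perp (sprod S T))" for S T by (simp add: phase_def)
  have a: "S \<oplus>\<^bsub>?D\<^esub> T = perp (sprod (perp S) (perp T))" for S T by (simp add: phase_def)
  have o: "\<one>\<^bsub>?D\<^esub> = perp (perp {u})" and z: "\<zero>\<^bsub>?D\<^esub> = perp {u}" by (simp_all add: phase_def)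
  have le: "S \<preceq>\<^bsub>?D\<^esub> T \<longleftrightarrow> S \<subseteq> T" for S T by (simp add: phase_def)
  note sub = perp_sub sprod_sub
  show "partial_order (order_reduct ?D)"
    by unfold_locales (auto simp: le)
  show "monoid ?D"
  proof
    fix x y z assume x: "x \<in> carrier ?D" and y: "y \<in> carrier ?D" and z: "z \<in> carrier ?D"
    then have s: "x \<subseteq> G" "y \<subseteq> G" "z \<subseteq> G" by (auto simp: cD)
    show "x \<otimes>\<^bsub>?D\<^esub> y \<in> carrier ?D" unfolding m by (intro perpD sub)
    show "x \<otimes>\<^bsub>?D\<^esub> y \<otimes>\<^bsub>?D\<^esub> z = x \<otimes>\<^bsub>?D\<^esub> (y \<otimes>\<^bsub>?D\<^esub> z)"
      unfolding m using s by (simp add: perp_sprod_cl perp_sprod_cl' sub sprod_assoc)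
  next
    show "\<one>\<^bsub>?D\<^esub> \<in> carrier ?D" unfolding o by (intro perpD sub)
  next
    fix x assume x: "x \<in> carrier ?D"
    then have s: "x \<subseteq> G" "perp (perp x) = x" by (auto simp: cD)
    show 1: "x \<otimes>\<^bsub>?D\<^esub> \<one>\<^bsub>?D\<^esub> = x"
      unfolding m o perp_sprod_cl'[OF unit_sub s(1)] by (simp add: sprod_unit[OF s(1)] s)
    show "\<one>\<^bsub>?D\<^esub> \<otimes>\<^bsub>?D\<^esub> x = x"
      using 1 unfolding m o by (simp only: sprod_comm[OF s(1) perp_sub])
  qed
  show "monoid (add_monoid ?D)"
  proof (unfold_locales, simp_all only: partial_object.simps monoid.simps)
    fix x y z assume x: "x \<in> carrier ?D" and y: "y \<in> carrier ?D" and z: "z \<in> carrier ?D"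
    show "x \<oplus>\<^bsub>?D\<^esub> y \<in> carrier ?D" unfolding a by (intro perpD sub)
    show "x \<oplus>\<^bsub>?D\<^esub> y \<oplus>\<^bsub>?D\<^esub> z = x \<oplus>\<^bsub>?D\<^esub> (y \<oplus>\<^bsub>?D\<^esub> z)"
      unfolding a by (simp add: perp_sprod_cl perp_sprod_cl' sub sprod_assoc)
  next
    show "\<zero>\<^bsub>?D\<^esub> \<in> carrier ?D" unfolding z by (intro perpD unit_sub)
  next
    fix x assume x: "x \<in> carrier ?D"
    then have s: "x \<subseteq> G" "perp (perp x) = x" by (auto simp: cD)
    show 1: "x \<oplus>\<^bsub>?D\<^esub> \<zero>\<^bsub>?D\<^esub> = x"
      unfolding a z perp_sprod_cl'[OF unit_sub perp_sub] by (simp add: sprod_unit[OF perp_sub] s)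
    show "\<zero>\<^bsub>?D\<^esub> \<oplus>\<^bsub>?D\<^esub> x = x"
      using 1 unfolding a z by (simp only: sprod_comm[OF perp_sub perp_sub])
  qed
  fix x y z assume x: "x \<in> carrier ?D" and y: "y \<in> carrier ?D"
  then have s: "x \<subseteq> G" "y \<subseteq> G" by (auto simp: cD)
  show mc: "x \<otimes>\<^bsub>?D\<^esub> y = y \<otimes>\<^bsub>?D\<^esub> x" unfolding m by (simp only: sprod_comm[OF s])
  show ac: "x \<oplus>\<^bsub>?D\<^esub> y = y \<oplus>\<^bsub>?D\<^esub> x" unfolding a by (simp only: sprod_comm[OF perp_sub perp_sub])
  assume z: "z \<in> carrier ?D"
  then have sz: "z \<subseteq> G" by (auto simp: cD)
  show "x \<otimes>\<^bsub>?D\<^esub> z \<preceq>\<^bsub>?D\<^esub> y \<otimes>\<^bsub>?D\<^esub> z" if "x \<preceq>\<^bsub>?D\<^esub> y"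
    using that unfolding m le by (intro perp_anti sprod_mono) auto
  show "z \<otimes>\<^bsub>?D\<^esub> x \<preceq>\<^bsub>?D\<^esub> z \<otimes>\<^bsub>?D\<^esub> y" if "x \<preceq>\<^bsub>?D\<^esub> y"
    using that unfolding m le by (intro perp_anti sprod_mono) auto
  show "x \<oplus>\<^bsub>?D\<^esub> z \<preceq>\<^bsub>?D\<^esub> y \<oplus>\<^bsub>?D\<^esub> z" if "x \<preceq>\<^bsub>?D\<^esub> y"
    using that unfolding a le by (intro perp_anti sprod_mono) auto
  show "z \<oplus>\<^bsub>?D\<^esub> x \<preceq>\<^bsub>?D\<^esub> z \<oplus>\<^bsub>?D\<^esub> y" if "x \<preceq>\<^bsub>?D\<^esub> y"
    using that unfolding a le by (intro perp_anti sprod_mono) auto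
  have hd: "x \<otimes>\<^bsub>?D\<^esub> (y \<oplus>\<^bsub>?D\<^esub> z) \<preceq>\<^bsub>?D\<^esub> (x \<otimes>\<^bsub>?D\<^esub> y) \<oplus>\<^bsub>?D\<^esub> z"
    if "x \<in> carrier ?D" "y \<in> carrier ?D" "z \<in> carrier ?D" for x y z
  proof -
    have s: "x \<subseteq> G" "y \<subseteq> G" "perp (perp x) = x" "perp (perp y) = y" using that by (auto simp: cD)
    have "sprod x (perp (sprod (perp y) (perp z)))
        \<subseteq> perp (sprod (perp (sprod x (perp (perp y)))) (perp z))"
      by (rule phase_mult_par) (simp_all only: s perp_sub)
    then have "sprod x (perp (sprod (perp y) (perp z))) \<subseteq> perp (sprod (perp (sprod x y)) (perp z))"
      by (simp only: s)
    from perp_anti[OF perp_anti[OF this]] show ?thesis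
      unfolding m a le by (simp only: perp3 sub s)
  qed
  show "x \<otimes>\<^bsub>?D\<^esub> (y \<oplus>\<^bsub>?D\<^esub> z) \<preceq>\<^bsub>?D\<^esub> (x \<otimes>\<^bsub>?D\<^esub> y) \<oplus>\<^bsub>?D\<^esub> z" by (rule hd[OF x y z])
  have "x \<otimes>\<^bsub>?D\<^esub> (y \<oplus>\<^bsub>?D\<^esub> z) = (z \<oplus>\<^bsub>?D\<^esub> y) \<otimes>\<^bsub>?D\<^esub> x"
    unfolding m a using s sz by (simp add: sprod_comm sub)
  moreover have "(x \<otimes>\<^bsub>?D\<^esub> y) \<oplus>\<^bsub>?D\<^esub> z = z \<oplus>\<^bsub>?D\<^esub> (y \<otimes>\<^bsub>?D\<^esub> x)"
    unfolding m a using sprod_comm[OF s] sprod_comm[OF perp_sub perp_sub] by simp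
  ultimately show "(z \<oplus>\<^bsub>?D\<^esub> y) \<otimes>\<^bsub>?D\<^esub> x \<preceq>\<^bsub>?D\<^esub> z \<oplus>\<^bsub>?D\<^esub> (y \<otimes>\<^bsub>?D\<^esub> x)"
    using hd[OF x y z] by simp
qed

lemma phase_complement:
  assumes "S \<in> carrier phase" shows "is_complement phase S (perp S)"
proof -
  have S: "S \<subseteq> G" using assms by (simp add: phase_def)
  have "perp (perp (sprod S (perp S))) \<subseteq> perp {u}"
    using perp_anti[OF perp_anti[OF sprod_perp_pole[OF S]]] perp3[OF unit_sub] by simp
  then show ?thesis
    using perp_one_par[OF S] S by (simp add: is_complement_def phase_def perp_sub perp3)
qed

lemma phase_complemented: "complemented_comm_bimonoid phase"
  by (intro complemented_comm_bimonoid.intro phase_comm_bimonoid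
      complemented_comm_bimonoid_axioms.intro) (blast intro: phase_complement)

lemma phase_compl: "S \<in> carrier phase \<Longrightarrow> compl phase S = perp S"
  by (rule comm_bimonoid.compl_eq[OF phase_comm_bimonoid _ phase_complement])

lemma perp_Union: "perp (\<Union>\<F>) = {p \<in> G. \<forall>S\<in>\<F>. p \<in> perp S}"
  by (auto simp: perp_def)

lemma phase_complete: "complete_lattice (order_reduct phase)"
proof -
  interpret O: partial_order "order_reduct phase"
    by (rule bimonoid.order[OF comm_bimonoid.axioms(1)[OF phase_comm_bimonoid]])
  show ?thesis
  proof (rule O.complete_latticeI)
    fix \<F> assume "\<F> \<subseteq> carrier (order_reduct phase)"
    then have F: "S \<subseteq> G" "perp (perp S) = S" if "S \<in> \<F>" for S using that by (auto simp: phase_def)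
    have U: "\<Union>\<F> \<subseteq> G" using F by blast
    have "is_lub (order_reduct phase) (perp (perp (\<Union>\<F>))) \<F>"
    proof -
      have "S \<subseteq> perp (perp (\<Union>\<F>))" if "S \<in> \<F>" for S using perp_ext[OF U] that by blast
      moreover have "perp (perp (\<Union>\<F>)) \<subseteq> T"
        if "\<forall>S\<in>\<F>. S \<subseteq> T" "perp (perp T) = T" for T
      proof -
        have "\<Union>\<F> \<subseteq> T" using that by blast
        from perp_anti[OF perp_anti[OF this]] show ?thesis using that by simp
      qed
      ultimately show ?thesis
        using F perp3[OF perp_sub, of "\<Union>\<F>"] perp_sub
        by (auto simp: least_def Upper_def phase_def)
    qed
    then show "\<exists>s. is_lub (order_reduct phase) s \<F>" by blast
    let ?I = "perp (\<Union>(perp ` \<F>))"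
    have "is_glb (order_reduct phase) ?I \<F>"
    proof -
      have U': "\<Union>(perp ` \<F>) \<subseteq> G" using perp_sub by blast
      have 1: "?I \<subseteq> S" if "S \<in> \<F>" for S using F(2)[OF that] that by (auto simp: perp_Union)
      have 2: "T \<subseteq> ?I" if "\<forall>S\<in>\<F>. T \<subseteq> S" "T \<subseteq> G" for T
        using that F(2) by (auto simp: perp_Union)
      show ?thesis
        using F perp3[OF U'] perp_sub 1 2
        by (auto simp: greatest_def Lower_def phase_def)
    qed
    then show "\<exists>i. is_glb (order_reduct phase) i \<F>" by blast
  qed
qed

lemma phase_join_dense: "join_dense (order_reduct phase) {perp (perp {p}) | p. p \<in> G}"
proof -
  have cD: "S \<in> carrier phase \<longleftrightarrow> S \<subseteq> G \<and> perp (perp S) = S" for S by (simp add: phase_def)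
  show ?thesis
    unfolding join_dense_def
  proof (intro conjI ballI)
    show "{perp (perp {p}) | p. p \<in> G} \<subseteq> carrier (order_reduct phase)"
      by (auto simp: phase_def perp3 intro: perp_sub[THEN subsetD])
    fix S assume "S \<in> carrier (order_reduct phase)"
    then have S: "S \<subseteq> G" "perp (perp S) = S" by (simp_all add: cD)
    let ?F = "{perp (perp {p}) | p. p \<in> S}"
    have 1: "perp (perp {p}) \<subseteq> S" if "p \<in> S" for p
      using perp_anti[OF perp_anti[of "{p}" S]] that S by simp
    have 2: "S \<subseteq> T" if "\<forall>p\<in>S. perp (perp {p}) \<subseteq> T" for T
      using that S perp_ext[of "{p}" for p] by blast
    have 3: "perp (perp {p}) \<in> carrier phase" if "p \<in> S" for p
      using that S perp3[OF perp_sub] by (simp add: cD perp_sub)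
    have "is_lub (order_reduct phase) S ?F"
    proof -
      have "S \<in> Upper (order_reduct phase) ?F"
        using 1 S unfolding Upper_def by (auto simp: phase_def)
      moreover have "S \<subseteq> T" if "T \<in> Upper (order_reduct phase) ?F" for T
      proof (rule 2, intro ballI)
        fix p assume p: "p \<in> S"
        then have "perp (perp {p}) \<in> ?F \<inter> carrier (order_reduct phase)" using 3 by auto
        then have "le (order_reduct phase) (perp (perp {p})) T" using that unfolding Upper_def by blast
        then show "perp (perp {p}) \<subseteq> T" by (simp add: phase_def)
      qed
      ultimately show ?thesis by (auto simp: least_def phase_def Upper_def)
    qed
    then show "\<exists>X\<subseteq>{perp (perp {p}) | p. p \<in> G}. is_lub (order_reduct phase) S X"
      using S(1) by (intro exI[of _ ?F]) blast
  qed
qed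

lemma phase_meet_dense: "meet_dense (order_reduct phase) {perp {p} | p. p \<in> G}"
proof -
  have cD: "S \<in> carrier phase \<longleftrightarrow> S \<subseteq> G \<and> perp (perp S) = S" for S by (simp add: phase_def)
  show ?thesis
    unfolding meet_dense_def
  proof (intro conjI ballI)
    show "{perp {p} | p. p \<in> G} \<subseteq> carrier (order_reduct phase)"
      by (auto simp: phase_def perp3 intro: perp_sub[THEN subsetD])
    fix S assume "S \<in> carrier (order_reduct phase)"
    then have S: "S \<subseteq> G" "perp (perp S) = S" by (simp_all add: cD)
    let ?F = "{perp {p} | p. p \<in> perp S}"
    have 1: "S \<subseteq> perp {p}" if "p \<in> perp S" for p
      using perp_anti[of "{p}" "perp S"] that S by simp
    have 2: "T \<subseteq> S" if "\<forall>p\<in>perp S. T \<subseteq> perp {p}" "T \<subseteq> G" for T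
    proof -
      have "T \<subseteq> perp (perp S)" using that by (auto simp: perp_def)
      then show ?thesis using S by simp
    qed
    have 3: "perp {p} \<in> carrier phase" if "p \<in> perp S" for p
    proof -
      have "{p} \<subseteq> G" using that perp_sub by blast
      then show ?thesis using perp3 by (simp add: cD perp_sub)
    qed
    have "is_glb (order_reduct phase) S ?F"
    proof -
      have "S \<in> Lower (order_reduct phase) ?F"
        using 1 S unfolding Lower_def by (auto simp: phase_def)
      moreover have "T \<subseteq> S" if "T \<in> Lower (order_reduct phase) ?F" for T
      proof (rule 2, intro ballI)
        fix p assume p: "p \<in> perp S"
        then have "perp {p} \<in> ?F \<inter> carrier (order_reduct phase)" using 3 by auto
        then have "le (order_reduct phase) T (perp {p})" using that unfolding Lower_def by blast
        then show "T \<subseteq> perp {p}" by (simp add: phase_def)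
      next
        show "T \<subseteq> G" using that by (simp add: Lower_def phase_def)
      qed
      ultimately show ?thesis by (auto simp: greatest_def phase_def Lower_def)
    qed
    then show "\<exists>X\<subseteq>{perp {p} | p. p \<in> G}. is_glb (order_reduct phase) S X"
      using perp_sub by (intro exI[of _ ?F]) blast
  qed
qed

end

context comm_bimonoid
begin

definition fpm where "fpm = (\<lambda>(a, b) (c, d). (a \<otimes> c, b \<oplus> d))"

definition fpole where "fpole = {(a, b). a \<in> carrier A \<and> b \<in> carrier A \<and> a \<preceq> b}"

definition fG where "fG = carrier A \<times> carrier A"

sublocale phase_space fG fpm "(\<one>, \<zero>)" fpole
  by unfold_locales
    (auto simp: fG_def fpm_def fpole_def m_closed a_closed m_assoc a_assoc
      m_one a_zero one_in zero_in intro: mult_comm add_comm)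

lemma perp_eq: "perp S = {(a, b). a \<in> carrier A \<and> b \<in> carrier A \<and>
    (\<forall>(c, d)\<in>S. a \<otimes> c \<in> carrier A \<and> b \<oplus> d \<in> carrier A \<and> a \<otimes> c \<preceq> b \<oplus> d)}"
  unfolding perp_def by (auto simp: fG_def fpm_def fpole_def)

lemma sing_sub: "a \<in> carrier A \<Longrightarrow> b \<in> carrier A \<Longrightarrow> {(a, b)} \<subseteq> fG"
  by (simp add: fG_def)

lemma mem_fG: "p \<in> fG \<longleftrightarrow> (\<exists>a b. p = (a, b) \<and> a \<in> carrier A \<and> b \<in> carrier A)"
  by (auto simp: fG_def)

lemma pair_in: "a \<in> carrier A \<Longrightarrow> b \<in> carrier A \<Longrightarrow> (a, b) \<in> fG"
  by (simp add: fG_def)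

definition phase_emb where "phase_emb a = perp (perp {(a, \<zero>)})"

lemma cl_pair:
  assumes "b \<in> carrier A" shows "perp (perp {(\<one>, b)}) = perp {(b, \<zero>)}"
proof
  note cl = assms m_closed a_closed one_in zero_in
  have "(b, \<zero>) \<in> perp {(\<one>, b)}"
    using assms by (simp add: perp_eq cl m_one a_zero ble_refl)
  then show "perp (perp {(\<one>, b)}) \<subseteq> perp {(b, \<zero>)}" by (intro perp_anti) simp
  show "perp {(b, \<zero>)} \<subseteq> perp (perp {(\<one>, b)})"
  proof (clarsimp simp: perp_eq cl m_one a_zero)
    fix x y u v assume c: "x \<in> carrier A" "y \<in> carrier A" "u \<in> carrier A" "v \<in> carrier A"
      and 1: "x \<otimes> b \<preceq> y" and 2: "u \<preceq> v \<oplus> b"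
    have a: "x \<otimes> u \<preceq> x \<otimes> (v \<oplus> b)" by (rule mult_mono_right) (simp_all add: cl c 2)
    have b: "x \<otimes> (v \<oplus> b) \<preceq> v \<oplus> (x \<otimes> b)" by (rule hemidist') (simp_all add: cl c)
    have d: "v \<oplus> (x \<otimes> b) \<preceq> v \<oplus> y" by (rule add_mono_right) (simp_all add: cl c 1)
    have "x \<otimes> u \<preceq> v \<oplus> y"
      by (rule ble_trans[OF a ble_trans[OF b d]]) (simp_all add: cl c)
    then show "x \<otimes> u \<preceq> y \<oplus> v" using add_comm c by simp
  qed
qed

lemma perp_pair:
  assumes "b \<in> carrier A" shows "perp (perp {(b, \<zero>)}) = perp {(\<one>, b)}"
  using cl_pair[OF assms] perp3[OF sing_sub[OF one_in assms]] by simp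

lemma phase_emb_in: "a \<in> carrier A \<Longrightarrow> phase_emb a \<in> carrier phase"
  by (simp add: phase_emb_def phase_def pair_in zero_in perp_sub perp3)

lemma sprod_sing: "sprod {(a, b)} {(c, d)} = {(a \<otimes> c, b \<oplus> d)}"
  unfolding sprod_def by (simp add: fpm_def)

lemma phase_emb_frac:
  assumes "a \<in> carrier A" "b \<in> carrier A"
  shows "phase_emb a \<otimes>\<^bsub>phase\<^esub> compl phase (phase_emb b) = perp (perp {(a, b)})"
proof -
  have "compl phase (phase_emb b) = perp (perp {(\<one>, b)})"
    using assms zero_in by (simp add: phase_compl phase_emb_in) (simp add: phase_emb_def pair_in perp3 cl_pair)
  then show ?thesis
    using assms one_in zero_in
    by (simp add: phase_def phase_emb_def pair_in perp_sprod_cl perp_sprod_cl' perp_sub sprod_sing m_one a_zero)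
qed

lemma phase_emb_cofrac:
  assumes "a \<in> carrier A" "b \<in> carrier A"
  shows "phase_emb a \<oplus>\<^bsub>phase\<^esub> compl phase (phase_emb b) = perp {(b, a)}"
proof -
  have 1: "perp (phase_emb a) = perp (perp {(\<one>, a)})"
    using assms zero_in by (simp add: phase_emb_def pair_in perp3 cl_pair)
  have 2: "perp (compl phase (phase_emb b)) = perp (perp {(b, \<zero>)})"
    using assms zero_in by (simp add: phase_compl phase_emb_in) (simp add: phase_emb_def pair_in perp3)
  have "phase_emb a \<oplus>\<^bsub>phase\<^esub> compl phase (phase_emb b)
      = perp (sprod (perp (phase_emb a)) (perp (compl phase (phase_emb b))))"
    by (simp add: phase_def)
  then show ?thesis unfolding 1 2
    using assms one_in zero_in
    by (simp add: pair_in perp_sprod_cl perp_sprod_cl' perp_sub sprod_sing m_one a_zero)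
qed

lemma phase_embedding: "bimonoid_embedding A phase phase_emb"
proof -
  have le: "phase_emb x \<subseteq> phase_emb y \<longleftrightarrow> x \<preceq> y" if "x \<in> carrier A" "y \<in> carrier A" for x y
  proof
    note cl = that m_closed a_closed one_in zero_in
    assume "phase_emb x \<subseteq> phase_emb y"
    moreover have "(x, \<zero>) \<in> phase_emb x"
      unfolding phase_emb_def using perp_ext[OF sing_sub[OF that(1) zero_in]] by simp
    ultimately have "(x, \<zero>) \<in> perp {(\<one>, y)}"
      using perp_pair[OF that(2)] by (auto simp: phase_emb_def)
    then show "x \<preceq> y" by (simp add: perp_eq cl m_one a_zero)
  next
    note cl = that m_closed a_closed one_in zero_in
    assume xy: "x \<preceq> y"
    show "phase_emb x \<subseteq> phase_emb y"
      unfolding phase_emb_def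
    proof (rule perp_anti, clarsimp simp: perp_eq cl m_one a_zero)
      fix u v assume c: "u \<in> carrier A" "v \<in> carrier A" "u \<otimes> y \<preceq> v"
      show "u \<otimes> x \<preceq> v"
        by (rule ble_trans[OF mult_mono_right c(3)]) (simp_all add: cl c xy)
    qed
  qed
  have mult: "phase_emb (x \<otimes> y) = phase_emb x \<otimes>\<^bsub>phase\<^esub> phase_emb y"
    if "x \<in> carrier A" "y \<in> carrier A" for x y
    using that zero_in
    by (simp add: phase_def phase_emb_def pair_in perp_sprod_cl perp_sprod_cl' perp_sub sprod_sing a_zero)
  have add: "phase_emb (x \<oplus> y) = phase_emb x \<oplus>\<^bsub>phase\<^esub> phase_emb y"
    if "x \<in> carrier A" "y \<in> carrier A" for x y
  proof -
    have "perp (phase_emb a) = perp (perp {(\<one>, a)})" if "a \<in> carrier A" for a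
      using that zero_in by (simp add: phase_emb_def pair_in perp3 cl_pair)
    moreover have "phase_emb x \<oplus>\<^bsub>phase\<^esub> phase_emb y
        = perp (sprod (perp (phase_emb x)) (perp (phase_emb y)))" by (simp add: phase_def)
    ultimately have "phase_emb x \<oplus>\<^bsub>phase\<^esub> phase_emb y = perp {(\<one>, x \<oplus> y)}"
      using that one_in
      by (simp add: pair_in perp_sprod_cl perp_sprod_cl' perp_sub sprod_sing m_one)
    then show ?thesis using that by (simp add: phase_emb_def perp_pair a_closed)
  qed
  show ?thesis
    unfolding bimonoid_embedding_def
    using le mult add phase_emb_in perp_pair[OF zero_in]
    by (auto simp: phase_def phase_emb_def)
qed

lemma phase_completion: "comm_compl_DM_completion A phase phase_emb"
proof -
  have "{phase_emb a \<otimes>\<^bsub>phase\<^esub> compl phase (phase_emb b) | a b. a \<in> carrier A \<and> b \<in> carrier A}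
      = {perp (perp {p}) | p. p \<in> fG}" (is "?Lfrac = ?Rfrac")
  proof (intro equalityI subsetI)
    fix w assume "w \<in> ?Lfrac"
    then obtain a b where "a \<in> carrier A" "b \<in> carrier A" "w = perp (perp {(a, b)})"
      using phase_emb_frac by auto
    then show "w \<in> ?Rfrac" using pair_in by blast
  next
    fix w assume "w \<in> ?Rfrac"
    then obtain p where w: "p \<in> fG" "w = perp (perp {p})" by blast
    then obtain a b where "p = (a, b)" "a \<in> carrier A" "b \<in> carrier A" using mem_fG by blast
    then have "w = phase_emb a \<otimes>\<^bsub>phase\<^esub> compl phase (phase_emb b)" "a \<in> carrier A" "b \<in> carrier A"
      using phase_emb_frac w by auto
    then show "w \<in> ?Lfrac" by blast
  qed
  moreover have "{phase_emb a \<oplus>\<^bsub>phase\<^esub> compl phase (phase_emb b) | a b. a \<in> carrier A \<and> b \<in> carrier A}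
      = {perp {p} | p. p \<in> fG}" (is "?Lcofrac = ?Rcofrac")
  proof (intro equalityI subsetI)
    fix w assume "w \<in> ?Lcofrac"
    then obtain a b where "a \<in> carrier A" "b \<in> carrier A" "w = perp {(b, a)}"
      using phase_emb_cofrac by auto
    then show "w \<in> ?Rcofrac" using pair_in by blast
  next
    fix w assume "w \<in> ?Rcofrac"
    then obtain p where w: "p \<in> fG" "w = perp {p}" by blast
    then obtain a b where "p = (b, a)" "a \<in> carrier A" "b \<in> carrier A" using mem_fG by blast
    then have "w = phase_emb a \<oplus>\<^bsub>phase\<^esub> compl phase (phase_emb b)" "a \<in> carrier A" "b \<in> carrier A"
      using phase_emb_cofrac w by auto
    then show "w \<in> ?Lcofrac" by blast
  qed
  ultimately show ?thesis
    unfolding comm_compl_DM_completion_def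
    using phase_complemented phase_complete phase_embedding phase_join_dense phase_meet_dense by simp
qed

end

lemma ex_comm_compl_DM_completion:
  fixes A :: "('a, 'm) bimonoid_scheme"
  assumes "comm_bimonoid A"
  shows "\<exists>(D :: ('a \<times> 'a) set bimonoid) e. comm_compl_DM_completion A D e"
  using comm_bimonoid.phase_completion[OF assms] by blast

end

theory Submission
  imports Defs
begin

text \<open>Read a pair \<open>(a, b)\<close> as the element \<open>a \<cdot> compl b\<close> of the completion. By residuation, such an
  element lies below the meet generator \<open>y + compl x\<close> iff \<open>x \<cdot> a \<le> y + b\<close>, so meet density says
  that \<open>frac_le\<close> is exactly the order pulled back from the completion. By the De Morgan laws and
  the defining equation of the transformation functions, the reading is a homomorphism from the
  algebra of pairs into the completion that takes \<open>neg\<close> to complementation. Hence \<open>frac_equiv\<close>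
  is its kernel, and the quotient is isomorphic to a complemented sub-bimonoid of the completion.\<close>

section \<open>Complements\<close>

context complemented_comm_bimonoid
begin

lemma compl_is_complement: "x \<in> carrier A \<Longrightarrow> is_complement A x (compl A x)"
  using ex_complement compl_eq by metis

lemma compl_closed: "x \<in> carrier A \<Longrightarrow> compl A x \<in> carrier A"
  and mult_compl_le: "x \<in> carrier A \<Longrightarrow> x \<otimes> compl A x \<preceq> \<zero>"
  and one_le_add_compl: "x \<in> carrier A \<Longrightarrow> \<one> \<preceq> x \<oplus> compl A x"
  using compl_is_complement by (simp_all add: is_complement_def)

lemmas closed = compl_closed m_closed a_closed one_in zero_in

lemma compl_compl: "x \<in> carrier A \<Longrightarrow> compl A (compl A x) = x"
  using mult_compl_le[of x] one_le_add_compl[of x] compl_closed[of x]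
  by (intro compl_eq) (simp_all add: is_complement_def mult_comm add_comm)

lemma compl_zero: "compl A \<zero> = \<one>"
  by (rule compl_eq) (simp_all add: is_complement_def closed m_one a_zero ble_refl)

text \<open>Residuation: multiplying by \<open>compl A y\<close> is left adjoint to adding
  \<open>y\<close>. The inequality \<one> \<preceq> \<open>y\<close> \<oplus>
  \<open>compl A y\<close> yields one direction and \<open>mult_compl_le\<close> the other, each
  combined with hemidistributivity.\<close>

lemma mult_compl_le_iff:
  assumes "x \<in> carrier A" "y \<in> carrier A" "z \<in> carrier A"
  shows "x \<otimes> compl A y \<preceq> z \<longleftrightarrow> x \<preceq> z \<oplus> y"
proof
  note cl = assms closed
  assume le: "x \<otimes> compl A y \<preceq> z"
  have "x \<otimes> \<one> \<preceq> x \<otimes> (y \<oplus> compl A y)"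
    by (rule mult_mono_right) (simp_all add: cl one_le_add_compl)
  moreover have "x \<otimes> (y \<oplus> compl A y) \<preceq> y \<oplus> x \<otimes> compl A y"
    by (rule hemidist') (simp_all add: cl)
  moreover have "y \<oplus> x \<otimes> compl A y \<preceq> y \<oplus> z"
    by (rule add_mono_right) (simp_all add: cl le)
  ultimately have "x \<otimes> \<one> \<preceq> y \<oplus> z"
    by (meson ble_trans cl)
  then show "x \<preceq> z \<oplus> y" by (simp add: cl m_one add_comm)
next
  note cl = assms closed
  assume le: "x \<preceq> z \<oplus> y"
  have "x \<otimes> compl A y \<preceq> (z \<oplus> y) \<otimes> compl A y"
    by (rule mult_mono_left) (simp_all add: cl le)
  moreover have "(z \<oplus> y) \<otimes> compl A y \<preceq> z \<oplus> (y \<otimes> compl A y)"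
    by (rule hemidist_right) (simp_all add: cl)
  moreover have "z \<oplus> (y \<otimes> compl A y) \<preceq> z \<oplus> \<zero>"
    by (rule add_mono_right) (simp_all add: cl mult_compl_le)
  ultimately have "x \<otimes> compl A y \<preceq> z \<oplus> \<zero>"
    by (meson ble_trans cl)
  then show "x \<otimes> compl A y \<preceq> z" by (simp add: cl a_zero)
qed

lemma mult_le_iff:
  assumes "x \<in> carrier A" "y \<in> carrier A" "z \<in> carrier A"
  shows "x \<otimes> y \<preceq> z \<longleftrightarrow> y \<preceq> z \<oplus> compl A x"
  using mult_compl_le_iff[of y "compl A x" z] assms
  by (simp add: closed compl_compl mult_comm)

text \<open>De Morgan. Residuating twice turns each of the two inequalities that define a complement
  into an instance of reflexivity.\<close>

lemma compl_add:
  assumes "x \<in> carrier A" "y \<in> carrier A"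
  shows "compl A (x \<oplus> y) = compl A x \<otimes> compl A y"
proof (rule compl_eq)
  note cl = assms closed
  show "x \<oplus> y \<in> carrier A" by (simp add: cl)
  have "((x \<oplus> y) \<otimes> compl A y) \<otimes> compl A x \<preceq> \<zero>"
    by (simp add: mult_compl_le_iff cl a_zero ble_refl)
  then have "(x \<oplus> y) \<otimes> (compl A x \<otimes> compl A y) \<preceq> \<zero>"
    by (simp add: cl m_assoc mult_comm[of "compl A x"])
  \<comment> \<open>The factor \<one> is kept so that both complements can be moved to the right by
    residuation, leaving \<one> alone on the left.\<close>
  moreover have "\<one> \<otimes> compl A x \<otimes> compl A y \<preceq> compl A x \<otimes> compl A y"
    by (simp add: cl m_one ble_refl)
  then have "\<one> \<preceq> compl A x \<otimes> compl A y \<oplus> y \<oplus> x"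
    by (simp only: mult_compl_le_iff cl)
  then have "\<one> \<preceq> (x \<oplus> y) \<oplus> compl A x \<otimes> compl A y"
    by (simp add: cl a_assoc add_comm)
  ultimately show "is_complement A (x \<oplus> y) (compl A x \<otimes> compl A y)"
    by (simp add: is_complement_def cl)
qed

text \<open>Addition is thus determined by multiplication and complementation; the addition of
  \<open>frac_alg\<close> follows this pattern.\<close>

lemma add_eq_compl_mult:
  assumes "x \<in> carrier A" "y \<in> carrier A"
  shows "x \<oplus> y = compl A (compl A x \<otimes> compl A y)"
  using compl_add[OF assms] compl_compl[of "x \<oplus> y"] assms by (simp add: closed)

end

section \<open>Quotients by kernels\<close>

text \<open>An embedding preserves the operations and reflects the order. Nothing is assumed of
  \<open>B\<close> beyond its signature, hence the closure hypotheses.\<close>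

lemma is_complement_reflect:
  assumes h: "bimonoid_embedding B D h" and "x \<in> carrier B" "y \<in> carrier B"
    and c: "x \<otimes>\<^bsub>B\<^esub> y \<in> carrier B" "x \<oplus>\<^bsub>B\<^esub> y \<in> carrier B" "\<one>\<^bsub>B\<^esub> \<in> carrier B" "\<zero>\<^bsub>B\<^esub> \<in> carrier B"
    and "is_complement D (h x) (h y)"
  shows "is_complement B x y"
  using assms unfolding is_complement_def bimonoid_embedding_def by metis

text \<open>Axioms that are equations or inequalities can be checked in \<open>D\<close>.
  Injectivity is a separate hypothesis because deriving it from order reflection would need
  antisymmetry in \<open>B\<close>, which is among the conclusions. Existence of complements is not
  of this form and is handled through \<open>compl\<close>.\<close>

lemma complemented_comm_bimonoid_reflect:
  fixes B :: "('b, 'm) bimonoid_scheme" and D :: "('d, 'n) bimonoid_scheme"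
  assumes D: "complemented_comm_bimonoid D"
    and emb: "bimonoid_embedding B D h" and inj: "inj_on h (carrier B)"
    and c: "\<And>x y. \<lbrakk>x \<in> carrier B; y \<in> carrier B\<rbrakk> \<Longrightarrow> x \<otimes>\<^bsub>B\<^esub> y \<in> carrier B"
      "\<And>x y. \<lbrakk>x \<in> carrier B; y \<in> carrier B\<rbrakk> \<Longrightarrow> x \<oplus>\<^bsub>B\<^esub> y \<in> carrier B"
      "\<one>\<^bsub>B\<^esub> \<in> carrier B" "\<zero>\<^bsub>B\<^esub> \<in> carrier B"
    and compl: "\<And>x. x \<in> carrier B \<Longrightarrow> \<exists>y\<in>carrier B. h y = compl D (h x)"
  shows "complemented_comm_bimonoid B"
proof -
  interpret D: complemented_comm_bimonoid D by (rule D)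
  have h: "x \<in> carrier B \<Longrightarrow> h x \<in> carrier D" for x
    using emb by (auto simp: bimonoid_embedding_def)
  have hom: "\<lbrakk>x \<in> carrier B; y \<in> carrier B\<rbrakk> \<Longrightarrow> h (x \<otimes>\<^bsub>B\<^esub> y) = h x \<otimes>\<^bsub>D\<^esub> h y"
    "\<lbrakk>x \<in> carrier B; y \<in> carrier B\<rbrakk> \<Longrightarrow> h (x \<oplus>\<^bsub>B\<^esub> y) = h x \<oplus>\<^bsub>D\<^esub> h y"
    "h \<one>\<^bsub>B\<^esub> = \<one>\<^bsub>D\<^esub>" "h \<zero>\<^bsub>B\<^esub> = \<zero>\<^bsub>D\<^esub>"
    "\<lbrakk>x \<in> carrier B; y \<in> carrier B\<rbrakk> \<Longrightarrow> x \<preceq>\<^bsub>B\<^esub> y \<longleftrightarrow> h x \<preceq>\<^bsub>D\<^esub> h y" for x y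
    using emb by (auto simp: bimonoid_embedding_def)
  have eq: "\<lbrakk>x \<in> carrier B; y \<in> carrier B\<rbrakk> \<Longrightarrow> x = y \<longleftrightarrow> h x = h y" for x y
    using inj by (auto dest: inj_onD)
  show ?thesis
  proof unfold_locales
    fix x assume "x \<in> carrier B"
    moreover from this obtain y where "y \<in> carrier B" "h y = compl D (h x)" using compl by blast
    ultimately have "is_complement B x y"
      using is_complement_reflect[OF emb] D.compl_is_complement[OF h] c by metis
    then show "\<exists>y. is_complement B x y" ..
  qed (auto simp: eq c hom h D.m_assoc D.a_assoc D.m_one D.a_zero D.ble_refl
      intro: D.mult_comm D.add_comm D.mult_mono_left D.mult_mono_right D.add_mono_left
        D.add_mono_right D.hemidist_left D.hemidist_right
        D.ble_antisym elim: D.ble_trans)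
qed

section \<open>Kernel quotient of an algebra mapped homomorphically into a complemented
  bimonoid\<close>

locale alg_hom_to_complemented = complemented_comm_bimonoid D
  for D :: "('d, 'n) bimonoid_scheme" (structure) +
  fixes P :: "'p bimonoid_alg" and h :: "'p \<Rightarrow> 'd"
  assumes P_closed: "\<lbrakk>p \<in> carrier P; q \<in> carrier P\<rbrakk> \<Longrightarrow> p \<otimes>\<^bsub>P\<^esub> q \<in> carrier P"
      "\<lbrakk>p \<in> carrier P; q \<in> carrier P\<rbrakk> \<Longrightarrow> p \<oplus>\<^bsub>P\<^esub> q \<in> carrier P"
      "\<one>\<^bsub>P\<^esub> \<in> carrier P" "\<zero>\<^bsub>P\<^esub> \<in> carrier P" "p \<in> carrier P \<Longrightarrow> neg P p \<in> carrier P"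
    and h_closed: "p \<in> carrier P \<Longrightarrow> h p \<in> carrier D"
    and h_hom: "\<lbrakk>p \<in> carrier P; q \<in> carrier P\<rbrakk> \<Longrightarrow> h (p \<otimes>\<^bsub>P\<^esub> q) = h p \<otimes> h q"
      "\<lbrakk>p \<in> carrier P; q \<in> carrier P\<rbrakk> \<Longrightarrow> h (p \<oplus>\<^bsub>P\<^esub> q) = h p \<oplus> h q"
      "h \<one>\<^bsub>P\<^esub> = \<one>" "h \<zero>\<^bsub>P\<^esub> = \<zero>" "p \<in> carrier P \<Longrightarrow> h (neg P p) = compl D (h p)"
    and h_le: "\<lbrakk>p \<in> carrier P; q \<in> carrier P\<rbrakk> \<Longrightarrow> p \<preceq>\<^bsub>P\<^esub> q \<longleftrightarrow> h p \<preceq> h q"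
begin

definition ker where "ker = {(p, q). p \<in> carrier P \<and> q \<in> carrier P \<and> h p = h q}"

abbreviation cls where "cls p \<equiv> ker `` {p}"

abbreviation quot where "quot \<equiv> quotient_alg P ker"

lemma equiv_ker: "equiv (carrier P) ker"
  by (rule equivI) (auto simp: ker_def refl_on_def sym_def trans_def)

lemma congruence_ker: "congruence P ker"
  unfolding congruence_def using equiv_ker by (auto simp: ker_def P_closed h_hom)

lemma cls_eq_iff: "\<lbrakk>p \<in> carrier P; q \<in> carrier P\<rbrakk> \<Longrightarrow> cls p = cls q \<longleftrightarrow> h p = h q"
  by (auto simp: ker_def)

lemma carrier_quot: "carrier quot = cls ` carrier P"
  by (auto simp: quotient_alg_def quotient_def)

lemma one_quot: "\<one>\<^bsub>quot\<^esub> = cls \<one>\<^bsub>P\<^esub>"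
  and zero_quot: "\<zero>\<^bsub>quot\<^esub> = cls \<zero>\<^bsub>P\<^esub>"
  by (simp_all add: quotient_alg_def)

text \<open>All products of representatives have the same value under \<open>h\<close>, so the union
  in \<open>quotient_alg\<close> ranges over copies of a single class.\<close>

lemma mult_quot:
  assumes "p \<in> carrier P" "q \<in> carrier P"
  shows "cls p \<otimes>\<^bsub>quot\<^esub> cls q = cls (p \<otimes>\<^bsub>P\<^esub> q)"
  using assms by (auto simp: quotient_alg_def ker_def P_closed h_hom)

lemma add_quot:
  assumes "p \<in> carrier P" "q \<in> carrier P"
  shows "cls p \<oplus>\<^bsub>quot\<^esub> cls q = cls (p \<oplus>\<^bsub>P\<^esub> q)"
  using assms by (auto simp: quotient_alg_def ker_def P_closed h_hom)

lemma ble_quot: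
  assumes "p \<in> carrier P" "q \<in> carrier P"
  shows "cls p \<preceq>\<^bsub>quot\<^esub> cls q \<longleftrightarrow> h p \<preceq> h q"
  using assms by (fastforce simp: quotient_alg_def ker_def h_le)

text \<open>The map induced by \<open>h\<close> on the quotient: \<open>h\<close> is constant on a
  class, so the image is a singleton and \<open>the_elem\<close> extracts its value.\<close>

lemma the_elem_image_cls: "p \<in> carrier P \<Longrightarrow> the_elem (h ` cls p) = h p"
  by (rule the_elem_image_unique) (auto simp: ker_def)

lemma embedding_quot: "bimonoid_embedding quot D (\<lambda>X. the_elem (h ` X))"
  by (auto simp: bimonoid_embedding_def carrier_quot mult_quot add_quot ble_quot one_quot
      zero_quot the_elem_image_cls P_closed h_hom h_closed)

lemma inj_on_quot: "inj_on (\<lambda>X. the_elem (h ` X)) (carrier quot)"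
  by (simp add: inj_on_def carrier_quot the_elem_image_cls cls_eq_iff)

lemma complemented_quot: "complemented_comm_bimonoid quot"
proof (rule complemented_comm_bimonoid_reflect)
  show "complemented_comm_bimonoid D" by unfold_locales
  show "bimonoid_embedding quot D (\<lambda>X. the_elem (h ` X))" by (rule embedding_quot)
  \<comment> \<open>For \<open>X\<close> the class of \<open>p\<close>, the witness is the class of
    \<open>neg P p\<close>.\<close>
  show "\<exists>Y\<in>carrier quot. the_elem (h ` Y) = compl D (the_elem (h ` X))"
    if "X \<in> carrier quot" for X
    using that P_closed(5) h_hom(5) the_elem_image_cls by (force simp: carrier_quot)
qed (use P_closed inj_on_quot in \<open>auto simp: carrier_quot mult_quot add_quot one_quot
      zero_quot\<close>)

text \<open>\<open>neg\<close> is only a unary operation of the signature; in the quotient it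
  becomes complementation, by reflection from \<open>D\<close> and uniqueness of
  complements.\<close>

lemma compl_quot:
  assumes "p \<in> carrier P"
  shows "compl quot (cls p) = cls (neg P p)"
proof -
  interpret Q: complemented_comm_bimonoid quot by (rule complemented_quot)
  have "is_complement quot (cls p) (cls (neg P p))"
    by (rule is_complement_reflect[OF embedding_quot])
      (use assms compl_is_complement[OF h_closed[OF assms]] in
        \<open>simp_all add: carrier_quot mult_quot add_quot one_quot zero_quot
          the_elem_image_cls P_closed h_hom\<close>)
  then show ?thesis using assms by (intro Q.compl_eq) (simp_all add: carrier_quot)
qed

end

section \<open>Fractions\<close>

text \<open>Backwards, \<open>v\<close> is the meet of some set of generators. They all lie above
  \<open>v\<close>, hence above \<open>u\<close>, so \<open>u\<close> is a lower bound of
  them.\<close>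

lemma le_iff_meet_dense:
  fixes D :: "('d, 'n) bimonoid_scheme"
  assumes "comm_bimonoid D" and S: "meet_dense (order_reduct D) S"
    and u: "u \<in> carrier D" and v: "v \<in> carrier D"
  shows "u \<preceq>\<^bsub>D\<^esub> v \<longleftrightarrow> (\<forall>s\<in>S. v \<preceq>\<^bsub>D\<^esub> s \<longrightarrow> u \<preceq>\<^bsub>D\<^esub> s)"
proof
  interpret comm_bimonoid D by fact
  have SD: "S \<subseteq> carrier D" using S by (simp add: meet_dense_def)
  { assume "u \<preceq>\<^bsub>D\<^esub> v"
    then show "\<forall>s\<in>S. v \<preceq>\<^bsub>D\<^esub> s \<longrightarrow> u \<preceq>\<^bsub>D\<^esub> s" using ble_trans SD u v by blast }
  assume *: "\<forall>s\<in>S. v \<preceq>\<^bsub>D\<^esub> s \<longrightarrow> u \<preceq>\<^bsub>D\<^esub> s"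
  obtain X where X: "X \<subseteq> S" "is_glb (order_reduct D) v X"
    using S v by (auto simp: meet_dense_def)
  have XD: "X \<subseteq> carrier D" using X SD by blast
  have "v \<preceq>\<^bsub>D\<^esub> s" if "s \<in> X" for s
    using X(2) that XD by (auto simp: greatest_def Lower_def)
  then have "u \<in> Lower (order_reduct D) X"
    using * X(1) u XD by (auto simp: Lower_def)
  then show "u \<preceq>\<^bsub>D\<^esub> v" using X(2) by (simp add: greatest_def)
qed

section \<open>Evaluation of pairs as fractions in the completion\<close>

locale transformed_bimonoid = A: comm_bimonoid A + complemented_comm_bimonoid D
  for A :: "'a bimonoid" and D :: "('d, 'n) bimonoid_scheme" (structure) +
  fixes e :: "'a \<Rightarrow> 'd" and \<alpha> \<beta> :: "'a \<times> 'a \<Rightarrow> 'a"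
  assumes completion: "comm_compl_DM_completion A D e"
    and transf: "transformation_functions A D e \<alpha> \<beta>"
begin

lemma e_closed: "a \<in> carrier A \<Longrightarrow> e a \<in> carrier D"
  and e_le: "\<lbrakk>a \<in> carrier A; b \<in> carrier A\<rbrakk> \<Longrightarrow> e a \<preceq> e b \<longleftrightarrow> a \<preceq>\<^bsub>A\<^esub> b"
  and e_mult: "\<lbrakk>a \<in> carrier A; b \<in> carrier A\<rbrakk> \<Longrightarrow> e (a \<otimes>\<^bsub>A\<^esub> b) = e a \<otimes> e b"
  and e_add: "\<lbrakk>a \<in> carrier A; b \<in> carrier A\<rbrakk> \<Longrightarrow> e (a \<oplus>\<^bsub>A\<^esub> b) = e a \<oplus> e b"
  and e_one: "e \<one>\<^bsub>A\<^esub> = \<one>"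
  and e_zero: "e \<zero>\<^bsub>A\<^esub> = \<zero>"
  using completion by (auto simp: comm_compl_DM_completion_def bimonoid_embedding_def)

lemma transf_closed:
  "\<lbrakk>a \<in> carrier A; b \<in> carrier A\<rbrakk> \<Longrightarrow> \<alpha> (a, b) \<in> carrier A"
  "\<lbrakk>a \<in> carrier A; b \<in> carrier A\<rbrakk> \<Longrightarrow> \<beta> (a, b) \<in> carrier A"
  using transf by (auto simp: transformation_functions_def)

definition frac :: "'a \<times> 'a \<Rightarrow> 'd" where "frac p = e (fst p) \<otimes> compl D (e (snd p))"

lemma frac_eq: "frac (a, b) = e a \<otimes> compl D (e b)"
  by (simp add: frac_def)

lemma frac_closed: "\<lbrakk>a \<in> carrier A; b \<in> carrier A\<rbrakk> \<Longrightarrow> frac (a, b) \<in> carrier D"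
  by (simp add: frac_eq closed e_closed)

text \<open>The complement of \<zero> is \<one>. This is why pairs with second entry \<zero>
  represent the elements of \<open>A\<close>.\<close>

lemma frac_zero: "a \<in> carrier A \<Longrightarrow> frac (a, \<zero>\<^bsub>A\<^esub>) = e a"
  by (simp add: frac_eq e_zero compl_zero m_one e_closed)

lemma frac_transf:
  "\<lbrakk>a \<in> carrier A; b \<in> carrier A\<rbrakk> \<Longrightarrow> frac (a, b) = e (\<alpha> (a, b)) \<oplus> compl D (e (\<beta> (a, b)))"
  using transf by (simp add: transformation_functions_def frac_eq)

lemma frac_neg:
  assumes "a \<in> carrier A" "b \<in> carrier A"
  shows "frac (\<beta> (a, b), \<alpha> (a, b)) = compl D (frac (a, b))"
  \<comment> \<open>The right-hand side is put into sum form first, so that De Morgan applies;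
    \<open>frac_eq\<close> would expand it as a product instead.\<close>
  by (simp add: frac_transf[OF assms])
    (simp add: assms frac_eq compl_add transf_closed e_closed closed compl_compl mult_comm)

text \<open>Second entries are added because De Morgan turns the complement of their sum into the
  product of their complements.\<close>

lemma frac_mult:
  assumes "a \<in> carrier A" "b \<in> carrier A" "c \<in> carrier A" "d \<in> carrier A"
  shows "frac (a \<otimes>\<^bsub>A\<^esub> c, b \<oplus>\<^bsub>A\<^esub> d) = frac (a, b) \<otimes> frac (c, d)"
proof -
  interpret M: comm_monoid D
    using mult_monoid mult_comm by (rule monoid.monoid_comm_monoidI)
  show ?thesis
    using assms by (simp add: frac_eq e_mult e_add compl_add e_closed closed M.m_ac)
qed

text \<open>The pair \<open>(s, t)\<close> reads as the product of the complements of the two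
  summands, and the outer use of \<beta> and \<alpha> complements it again.\<close>

lemma frac_add:
  assumes "a \<in> carrier A" "b \<in> carrier A" "c \<in> carrier A" "d \<in> carrier A"
  defines "s \<equiv> \<beta> (a, b) \<otimes>\<^bsub>A\<^esub> \<beta> (c, d)" and "t \<equiv> \<alpha> (a, b) \<oplus>\<^bsub>A\<^esub> \<alpha> (c, d)"
  shows "frac (\<beta> (s, t), \<alpha> (s, t)) = frac (a, b) \<oplus> frac (c, d)"
proof -
  have "frac (\<beta> (s, t), \<alpha> (s, t)) = compl D (frac (s, t))"
    by (rule frac_neg) (simp_all add: assms transf_closed A.m_closed A.a_closed)
  also have "frac (s, t) = compl D (frac (a, b)) \<otimes> compl D (frac (c, d))"
    by (simp add: assms frac_mult transf_closed frac_neg)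
  finally show ?thesis
    by (simp add: add_eq_compl_mult[of "frac (a, b)"] assms frac_closed)
qed

text \<open>Two residuations move \<open>compl D (e x)\<close> to the left as a factor
  \<open>e x\<close> and \<open>compl D (e b)\<close> to the right as a summand \<open>e b\<close>.
  Both sides then lie in the image of \<open>e\<close>, which reflects the order.\<close>

lemma frac_le_meet_generator:
  assumes "a \<in> carrier A" "b \<in> carrier A" "x \<in> carrier A" "y \<in> carrier A"
  shows "frac (a, b) \<preceq> e y \<oplus> compl D (e x) \<longleftrightarrow> x \<otimes>\<^bsub>A\<^esub> a \<preceq>\<^bsub>A\<^esub> y \<oplus>\<^bsub>A\<^esub> b"
proof -
  note cl = assms closed e_closed
  have "frac (a, b) \<preceq> e y \<oplus> compl D (e x) \<longleftrightarrow> e x \<otimes> (e a \<otimes> compl D (e b)) \<preceq> e y"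
    by (simp add: frac_eq mult_le_iff cl)
  also have "\<dots> \<longleftrightarrow> e x \<otimes> e a \<preceq> e y \<oplus> e b"
    \<comment> \<open>Reassociation makes \<open>compl D (e b)\<close> the last factor, as
      residuation requires.\<close>
    by (simp add: mult_compl_le_iff cl flip: m_assoc)
  also have "\<dots> \<longleftrightarrow> x \<otimes>\<^bsub>A\<^esub> a \<preceq>\<^bsub>A\<^esub> y \<oplus>\<^bsub>A\<^esub> b"
    by (simp add: cl A.m_closed A.a_closed flip: e_mult e_add e_le)
  finally show ?thesis .
qed

text \<open>The quantified \<open>x\<close> and \<open>y\<close> in \<open>frac_le\<close> enumerate
  the meet generators, so its condition is the criterion of
  \<open>le_iff_meet_dense\<close>.\<close>

lemma frac_le_iff:
  assumes "a \<in> carrier A" "b \<in> carrier A" "c \<in> carrier A" "d \<in> carrier A"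
  shows "frac_le A (a, b) (c, d) \<longleftrightarrow> frac (a, b) \<preceq> frac (c, d)"
proof -
  let ?S = "{e y \<oplus> compl D (e x) | y x. y \<in> carrier A \<and> x \<in> carrier A}"
  have "meet_dense (order_reduct D) ?S"
    using completion by (simp add: comm_compl_DM_completion_def)
  then have "frac (a, b) \<preceq> frac (c, d) \<longleftrightarrow> (\<forall>s\<in>?S. frac (c, d) \<preceq> s \<longrightarrow> frac (a, b) \<preceq> s)"
    using assms by (intro le_iff_meet_dense frac_closed) unfold_locales
  also have "\<dots> \<longleftrightarrow> (\<forall>x\<in>carrier A. \<forall>y\<in>carrier A.
      frac (c, d) \<preceq> e y \<oplus> compl D (e x) \<longrightarrow> frac (a, b) \<preceq> e y \<oplus> compl D (e x))"
    by blast
  also have "\<dots> \<longleftrightarrow> frac_le A (a, b) (c, d)"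
    using assms by (simp add: frac_le_def frac_le_meet_generator)
  finally show ?thesis ..
qed

sublocale F: alg_hom_to_complemented D "frac_alg A \<alpha> \<beta>" frac
  by unfold_locales
    (auto simp: frac_alg_def Let_def A.m_closed A.a_closed A.one_in A.zero_in transf_closed
      frac_closed frac_mult frac_add frac_neg frac_zero e_one e_zero frac_le_iff
      add_eq_compl_mult)

section \<open>The quotient as a bimonoid of fractions\<close>

lemma pair_in_frac_alg:
  "(a, b) \<in> carrier (frac_alg A \<alpha> \<beta>) \<longleftrightarrow> a \<in> carrier A \<and> b \<in> carrier A"
  by (simp add: frac_alg_def)

text \<open>Mutual inequality of pairs becomes equality of their values by antisymmetry in
  \<open>D\<close>.\<close>

lemma frac_equiv_eq_ker: "frac_equiv A = F.ker"
  by (auto simp: frac_equiv_def F.ker_def pair_in_frac_alg frac_le_iff frac_closed ble_refl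
      intro: ble_antisym)

lemma compl_cls:
  assumes "a \<in> carrier A" "b \<in> carrier A"
  shows "compl F.quot (F.cls (a, b)) = F.cls (\<beta> (a, b), \<alpha> (a, b))"
  using F.compl_quot[of "(a, b)"] assms by (simp add: pair_in_frac_alg) (simp add: frac_alg_def)

text \<open>Classes are compared through \<open>frac\<close>: both sides evaluate to
  \<open>e a\<close> times the complement of \<open>e b\<close>.\<close>

lemma cls_mult_compl:
  assumes "a \<in> carrier A" "b \<in> carrier A"
  shows "F.cls (a, \<zero>\<^bsub>A\<^esub>) \<otimes>\<^bsub>F.quot\<^esub> compl F.quot (F.cls (b, \<zero>\<^bsub>A\<^esub>)) = F.cls (a, b)"
  using assms
  by (simp add: F.compl_quot F.mult_quot pair_in_frac_alg A.zero_in F.P_closed F.cls_eq_iff F.h_hom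
      frac_zero frac_eq[of a b])

text \<open>Under \<open>frac\<close> this is the defining equation of the transformation functions.
  It supplies the representation of every class as a sum.\<close>

lemma cls_add_compl:
  assumes "a \<in> carrier A" "b \<in> carrier A"
  shows "F.cls (\<alpha> (a, b), \<zero>\<^bsub>A\<^esub>) \<oplus>\<^bsub>F.quot\<^esub> compl F.quot (F.cls (\<beta> (a, b), \<zero>\<^bsub>A\<^esub>)) = F.cls (a, b)"
  using assms
  by (simp add: F.compl_quot F.add_quot pair_in_frac_alg A.zero_in F.P_closed F.cls_eq_iff F.h_hom
      frac_zero frac_transf[of a b] transf_closed)

lemma cls_embedding: "bimonoid_embedding A F.quot (\<lambda>a. F.cls (a, \<zero>\<^bsub>A\<^esub>))"
proof -
  have "F.cls (x \<oplus>\<^bsub>A\<^esub> y, \<zero>\<^bsub>A\<^esub>) = F.cls (x, \<zero>\<^bsub>A\<^esub>) \<oplus>\<^bsub>F.quot\<^esub> F.cls (y, \<zero>\<^bsub>A\<^esub>)"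
    "F.cls (x \<otimes>\<^bsub>A\<^esub> y, \<zero>\<^bsub>A\<^esub>) = F.cls (x, \<zero>\<^bsub>A\<^esub>) \<otimes>\<^bsub>F.quot\<^esub> F.cls (y, \<zero>\<^bsub>A\<^esub>)"
    if "x \<in> carrier A" "y \<in> carrier A" for x y
    using that by (simp_all add: F.add_quot F.mult_quot pair_in_frac_alg A.zero_in A.a_closed
      A.m_closed F.P_closed F.cls_eq_iff F.h_hom frac_zero e_add e_mult)
  \<comment> \<open>These pairs are literally the constants of \<open>frac_alg\<close>, so no
    evaluation in \<open>D\<close> is involved.\<close>
  moreover have "F.cls (\<one>\<^bsub>A\<^esub>, \<zero>\<^bsub>A\<^esub>) = \<one>\<^bsub>F.quot\<^esub>" "F.cls (\<zero>\<^bsub>A\<^esub>, \<zero>\<^bsub>A\<^esub>) = \<zero>\<^bsub>F.quot\<^esub>"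
    by (simp_all add: F.one_quot F.zero_quot) (simp_all add: frac_alg_def)
  ultimately show ?thesis
    by (auto simp: bimonoid_embedding_def F.carrier_quot F.ble_quot pair_in_frac_alg
        A.zero_in frac_zero e_le)
qed

lemma fractions_quot: "comm_compl_bimonoid_of_fractions A F.quot (\<lambda>a. F.cls (a, \<zero>\<^bsub>A\<^esub>))"
  unfolding comm_compl_bimonoid_of_fractions_def
proof (intro conjI ballI)
  fix X assume "X \<in> carrier F.quot"
  then obtain a b where ab: "a \<in> carrier A" "b \<in> carrier A" and X: "X = F.cls (a, b)"
    by (auto simp: F.carrier_quot pair_in_frac_alg)
  show "\<exists>a\<in>carrier A. \<exists>b\<in>carrier A.
      X = F.cls (a, \<zero>\<^bsub>A\<^esub>) \<otimes>\<^bsub>F.quot\<^esub> compl F.quot (F.cls (b, \<zero>\<^bsub>A\<^esub>))"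
    unfolding X using ab cls_mult_compl by metis
  show "\<exists>c\<in>carrier A. \<exists>d\<in>carrier A.
      X = F.cls (c, \<zero>\<^bsub>A\<^esub>) \<oplus>\<^bsub>F.quot\<^esub> compl F.quot (F.cls (d, \<zero>\<^bsub>A\<^esub>))"
    unfolding X using ab cls_add_compl transf_closed by metis
qed (rule F.complemented_quot cls_embedding)+

end

theorem mainTheorem14:
  fixes A :: "'a bimonoid" and D :: "'d bimonoid" and e :: "'a \<Rightarrow> 'd"
    and \<alpha> \<beta> :: "'a \<times> 'a \<Rightarrow> 'a"
  defines "P \<equiv> frac_alg A \<alpha> \<beta>"
    and "\<theta> \<equiv> frac_equiv A"
  defines "Q \<equiv> quotient_alg P \<theta>"
    and "\<iota> \<equiv> (\<lambda>a. \<theta> `` {(a, \<zero>\<^bsub>A\<^esub>)})"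
  assumes "comm_bimonoid A"
    and "comm_compl_DM_completion A D e"
    and "transformation_functions A D e \<alpha> \<beta>"
  shows "congruence P \<theta> \<and>
    comm_compl_bimonoid_of_fractions A Q \<iota> \<and>
    (\<forall>a\<in>carrier A. \<forall>b\<in>carrier A. \<iota> a \<otimes>\<^bsub>Q\<^esub> compl Q (\<iota> b) = \<theta> `` {(a, b)}) \<and>
    (\<forall>a\<in>carrier A. \<forall>b\<in>carrier A.
       compl Q (\<theta> `` {(a, b)}) = \<theta> `` {(\<beta> (a, b), \<alpha> (a, b))})"
proof -
  have "complemented_comm_bimonoid D"
    using assms(6) by (simp add: comm_compl_DM_completion_def)
  then interpret transformed_bimonoid A D e \<alpha> \<beta>
    using assms(5-7) by (simp add: transformed_bimonoid_def transformed_bimonoid_axioms_def)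
  show ?thesis
    \<comment> \<open>Replacing \<open>frac_equiv\<close> by the kernel identifies \<open>Q\<close>
      with \<open>F.quot\<close> and the classes of \<theta> with \<open>F.cls\<close>.\<close>
    unfolding P_def \<theta>_def Q_def \<iota>_def frac_equiv_eq_ker
    using F.congruence_ker fractions_quot cls_mult_compl compl_cls by blast
qed

end
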